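(* Let $\mathcal{D}=(d_k)_{k\ge1}$ be a sequence of integers with $d_k\ge 2$ for all $k$. Then the set of real numbers $\alpha$ such that $$\liminf_{q\to\infty}\ q\cdot \log q\cdot \log\log q\cdot |q|_{\mathcal{D}}\cdot \|q\alpha\|>0$$ has Hausdorff dimension equal to $1$.
   Context: $\|x\|$ denotes the distance from $x\in\mathbb{R}$ to the nearest integer. For the sequence $\mathcal{D}$, set $D_0:=1$ and $D_n:=\prod_{k=1}^n d_k$ for $n\ge1$, and for $q\in\mathbb{Z}$ define $|q|_{\mathcal{D}}:=\inf\{D_n^{-1} : n\ge 0,\ q\in D_n\mathbb{Z}\}$. The $\liminf$ is over positive integers $q\to\infty$. *)

theory Defs
  imports "HOL-Analysis.Analysis"
begin

text \<open>
  The contribution \<open>diam(U)\<^sup>s\<close> of a covering set, with the usual conventions that the empty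
  set contributes \<open>0\<close> and that \<open>0\<^sup>0 = 1\<close> for nonempty sets (whereas \<open>0 powr 0 = 0\<close>).
\<close>
definition diam_pow :: "real \<Rightarrow> 'a::metric_space set \<Rightarrow> ennreal" where
  "diam_pow s U = (if U = {} then 0 else if s = 0 then 1 else ennreal (diameter U powr s))"

text \<open>
  Boundedness of the covering sets is required explicitly because \<^const>\<open>diameter\<close> is a real
  number, hence unspecified on unbounded sets. Finite covers are included, since sets in the
  family may be empty.
\<close>
definition hausdorff_premeasure :: "real \<Rightarrow> real \<Rightarrow> 'a::metric_space set \<Rightarrow> ennreal" where
  "hausdorff_premeasure s \<delta> A =
     Inf {(\<Sum>i. diam_pow s (U i)) | U :: nat \<Rightarrow> 'a set.
            A \<subseteq> (\<Union>i. U i) \<and> (\<forall>i. bounded (U i) \<and> diameter (U i) \<le> \<delta>)}"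

definition hausdorff_measure :: "real \<Rightarrow> 'a::metric_space set \<Rightarrow> ennreal" where
  "hausdorff_measure s A = (SUP \<delta>\<in>{0<..}. hausdorff_premeasure s \<delta> A)"

definition hausdorff_dim :: "'a::metric_space set \<Rightarrow> ennreal" where
  "hausdorff_dim A = (INF s\<in>{s. 0 \<le> s \<and> hausdorff_measure s A = 0}. ennreal s)"

definition dist_int :: "real \<Rightarrow> real" where
  "dist_int x = infdist x \<int>"

text \<open>The sequence is indexed from \<open>1\<close>; the value \<open>d 0\<close> is never used.\<close>
definition Dprod :: "(nat \<Rightarrow> int) \<Rightarrow> nat \<Rightarrow> int" where
  "Dprod d n = (\<Prod>k=1..n. d k)"

definition pseudo_abs :: "(nat \<Rightarrow> int) \<Rightarrow> int \<Rightarrow> real" where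
  "pseudo_abs d q = Inf {inverse (real_of_int (Dprod d n)) | n. Dprod d n dvd q}"

end

theory Submission
  imports Defs
begin

text \<open>
  Give a fraction \<open>p/q\<close> the height \<open>q\<^sup>2 |q|\<^sub>D\<close>. It suffices that \<open>\<alpha>\<close> keeps distance
  \<open>\<epsilon> / (2 ^ j j log j)\<close> from all fractions of height about \<open>2 ^ j\<close>. These fall into at most
  \<open>j + 1\<close> classes according to \<open>|q|\<^sub>D = 1 / D\<^sub>k\<close>, and two distinct rationals of the same class
  are \<open>2 ^ - (j + 1)\<close> apart. Cut an interval successively into dyadic intervals of length
  \<open>2 ^ - e\<^sub>t\<close> with \<open>2 ^ (e\<^bsub>t+1\<^esub> - e\<^sub>t)\<close> a large multiple of \<open>e\<^sub>t\<close>. The fractions of height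
  between \<open>2 ^ e\<^sub>t\<close> and \<open>2 ^ e\<^bsub>t+1\<^esub>\<close> then remove at most \<open>1/16\<close> of the level \<open>t + 2\<close> descendants
  of any level \<open>t\<close> interval, so one can keep half of the children at every step. As the
  numbers of children tend to infinity, the Cantor set that remains has dimension \<open>1\<close>.
\<close>

section \<open>Upper bound for the dimension of subsets of the line\<close>

text \<open>Intervals of lengths \<open>\<theta> / (k + 1)\<close> laid end to end in both
  directions exhaust the line because the harmonic series diverges, while the \<open>s\<close>-th
  powers of these lengths are summable for \<open>s > 1\<close>. Shrinking \<open>\<theta>\<close>
  makes that sum arbitrarily small.\<close>

lemma hausdorff_measure_real_eq_0:
  fixes A :: "real set"
  assumes s: "s > 1"
  shows "hausdorff_measure s A = 0"
proof -
  \<comment> \<open>The factor 2 arises because both half-lines share one enumeration: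
    \<open>U i\<close> below has length \<open>\<theta> / (i div 2 + 1)\<close>, at most
    \<open>2 * \<theta> / (i + 1)\<close>.\<close>
  define g where "g = (\<lambda>i::nat. (2 / (real i + 1)) powr s)"
  have g_eq: "g i = 2 powr s * (real (i + 1) powr (- s))" for i
    unfolding g_def by (simp add: powr_divide powr_minus field_simps)
  have "summable (\<lambda>i::nat. real (i + 1) powr (- s))"
    using s summable_real_powr_iff[of "- s"] by (subst summable_iff_shift) simp
  then have sg: "summable g"
    unfolding g_eq[abs_def] by (rule summable_mult)
  have g0: "g i \<ge> 0" for i
    by (simp add: g_def)
  have S0: "suminf g \<ge> 0"
    using g0 sg by (simp add: suminf_nonneg)
  have small: "hausdorff_premeasure s \<delta> A \<le> ennreal \<eta>" if \<delta>: "\<delta> > 0" and \<eta>: "\<eta> > 0" for \<delta> \<eta>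
  proof -
    \<comment> \<open>The second argument of \<open>min\<close> solves
      \<open>\<theta> powr s * (suminf g + 1) = \<eta>\<close>; the added 1 keeps the denominator
      positive.\<close>
    define \<theta> where "\<theta> = min \<delta> ((\<eta> / (suminf g + 1)) powr (1 / s))"
    have \<theta>: "\<theta> > 0" "\<theta> \<le> \<delta>"
      using \<delta> \<eta> S0 by (auto simp: \<theta>_def)
    have "\<theta> powr s \<le> ((\<eta> / (suminf g + 1)) powr (1 / s)) powr s"
      using s \<theta> by (intro powr_mono2) (auto simp: \<theta>_def)
    also have "\<dots> = \<eta> / (suminf g + 1)"
      using s \<eta> S0 by (simp add: powr_powr)
    finally have "\<theta> powr s * suminf g \<le> \<eta> / (suminf g + 1) * suminf g"
      using S0 by (rule mult_right_mono)
    also have "\<dots> \<le> \<eta>"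
      using S0 \<eta> by (simp add: field_simps)
    finally have \<theta>\<eta>: "\<theta> powr s * suminf g \<le> \<eta>" .
    define h where "h = (\<lambda>i. \<Sum>k<i. \<theta> / (real k + 1))"
    define U where "U = (\<lambda>i::nat. if even i then {h (i div 2)..h (Suc (i div 2))}
                                  else {- h (Suc (i div 2))..- h (i div 2)})"
    have h_Suc: "h (Suc i) = h i + \<theta> / (real i + 1)" for i
      by (simp add: h_def)
    have h_le: "h i \<le> h (Suc i)" for i
      using \<theta> by (simp add: h_Suc)
    have "\<not> summable (\<lambda>k. \<theta> / (real k + 1))"
    proof
      assume "summable (\<lambda>k. \<theta> / (real k + 1))"
      then have "summable (\<lambda>k. inverse \<theta> * (\<theta> / (real k + 1)))"
        by (rule summable_mult)
      then have "summable (\<lambda>k. inverse (real (Suc k)))"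
        using \<theta> by (simp add: field_simps)
      then show False
        using not_summable_harmonic[where 'a = real]
          summable_Suc_iff[of "\<lambda>k. inverse (real k)"] by simp
    qed
    then have unb: "\<exists>i. h i > x" for x
    proof -
      have "\<exists>i. \<not> h i \<le> x"
      proof (rule ccontr)
        assume "\<nexists>i. \<not> h i \<le> x"
        then have "summable (\<lambda>k. \<theta> / (real k + 1))"
          using \<theta> by (intro bounded_imp_summable[where B = x])
            (auto simp: h_def simp del: sum.lessThan_Suc simp flip: lessThan_Suc_atMost)
        then show False
          using \<open>\<not> summable _\<close> by simp
      qed
      then show ?thesis by (auto simp: not_le)
    qed
    have loc: "\<exists>i. h i \<le> x \<and> x \<le> h (Suc i)" if "x \<ge> 0" for x
    proof -
      define n where "n = (LEAST i. h i > x)"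
      have n: "h n > x"
        unfolding n_def using unb by (rule LeastI_ex)
      with that have "n \<noteq> 0"
        by (intro notI) (simp add: h_def)
      then obtain i where i: "n = Suc i"
        by (cases n) auto
      then have "\<not> h i > x"
        unfolding n_def using not_less_Least by (metis lessI)
      with i n show ?thesis by (intro exI[of _ i]) auto
    qed
    have cover: "A \<subseteq> (\<Union>i. U i)"
    proof
      fix x :: real
      show "x \<in> (\<Union>i. U i)"
      proof (cases "x \<ge> 0")
        case True
        then obtain i where "h i \<le> x \<and> x \<le> h (Suc i)" using loc by blast
        then have "x \<in> U (2 * i)" by (simp add: U_def)
        then show ?thesis by blast
      next
        case False
        then obtain i where "h i \<le> - x \<and> - x \<le> h (Suc i)" using loc[of "- x"] by auto
        then have "x \<in> U (2 * i + 1)" by (simp add: U_def)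
        then show ?thesis by blast
      qed
    qed
    have diam: "diameter (U i) = \<theta> / (real (i div 2) + 1)" for i
      using h_le[of "i div 2"] by (simp add: U_def h_Suc)
    have ne: "U i \<noteq> {}" for i
      using h_le[of "i div 2"] by (simp add: U_def)
    have half: "real (i div 2) + 1 \<ge> (real i + 1) / 2" for i
    proof -
      have "i + 1 \<le> 2 * (i div 2 + 1)" by presburger
      then have "real (i + 1) \<le> real (2 * (i div 2 + 1))" by (rule of_nat_mono)
      then show ?thesis by simp
    qed
    have diam_le: "diameter (U i) \<le> \<theta> * (2 / (real i + 1))" for i
    proof -
      have "\<theta> / (real (i div 2) + 1) \<le> \<theta> / ((real i + 1) / 2)"
        using \<theta> half by (intro divide_left_mono) (auto intro!: mult_pos_pos simp: add_pos_nonneg)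
      then show ?thesis by (simp add: diam)
    qed
    have "diameter (U i) \<le> \<theta> / 1" for i
      unfolding diam using \<theta> by (intro divide_left_mono) auto
    then have "bounded (U i) \<and> diameter (U i) \<le> \<delta>" for i
      using \<theta> order_trans[of "diameter (U i)" \<theta> \<delta>] by (simp add: U_def)
    then have "hausdorff_premeasure s \<delta> A \<le> (\<Sum>i. diam_pow s (U i))"
      unfolding hausdorff_premeasure_def using cover by (intro Inf_lower) blast
    also have "\<dots> \<le> (\<Sum>i. ennreal (\<theta> powr s * g i))"
    proof (intro suminf_le)
      fix i
      have "diameter (U i) powr s \<le> (\<theta> * (2 / (real i + 1))) powr s"
        using s diam_le \<theta> by (intro powr_mono2) (auto simp: diam)
      also have "\<dots> = \<theta> powr s * g i"
        using \<theta> by (subst powr_mult) (auto simp: g_def)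
      finally show "diam_pow s (U i) \<le> ennreal (\<theta> powr s * g i)"
        using ne s by (simp add: diam_pow_def ennreal_leI)
    qed auto
    also have "\<dots> = ennreal (\<theta> powr s * suminf g)"
      using sg g0 by (subst suminf_ennreal2) (auto intro: summable_mult simp: suminf_mult)
    also have "\<dots> \<le> ennreal \<eta>"
      using \<theta>\<eta> by (rule ennreal_leI)
    finally show ?thesis .
  qed
  have "hausdorff_premeasure s \<delta> A \<le> 0" if "\<delta> > 0" for \<delta>
  proof (rule ennreal_le_epsilon)
    fix \<eta> :: real
    assume "\<eta> > 0"
    then show "hausdorff_premeasure s \<delta> A \<le> 0 + ennreal \<eta>"
      using small[OF \<open>\<delta> > 0\<close>] by simp
  qed
  then have "hausdorff_measure s A \<le> 0"
    unfolding hausdorff_measure_def by (intro SUP_least) simp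
  then show ?thesis by simp
qed

lemma hausdorff_dim_real_le_1: "hausdorff_dim (A :: real set) \<le> 1"
proof (rule ennreal_le_epsilon)
  fix e :: real
  assume "e > 0"
  then have "hausdorff_dim A \<le> ennreal (1 + e)"
    unfolding hausdorff_dim_def
    by (intro INF_lower) (auto simp: hausdorff_measure_real_eq_0)
  then show "hausdorff_dim A \<le> 1 + ennreal e"
    using \<open>e > 0\<close> by (simp add: ennreal_plus flip: ennreal_1)
qed

section \<open>Counting dyadic intervals\<close>

text \<open>Closed intervals, so that nested ones have a common point by compactness; the shared
  endpoints cost only a constant in the counts. With this indexing \<open>m div 2 ^ l\<close> is the
  ancestor \<open>l\<close> generations up.\<close>

definition cell :: "nat \<Rightarrow> nat \<Rightarrow> real set" where
  "cell m i = {real i / 2 ^ m .. (real i + 1) / 2 ^ m}"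

text \<open>Rounding \<open>(x - u) / \<eta>\<close> down is injective on \<open>P\<close>, since a
  gap of at least \<open>\<eta>\<close> raises the value by at least 1.\<close>

lemma card_separated_le:
  fixes P :: "real set"
  assumes sep: "\<And>x y. x \<in> P \<Longrightarrow> y \<in> P \<Longrightarrow> x < y \<Longrightarrow> y - x \<ge> \<eta>"
    and \<eta>: "\<eta> > 0" and P: "P \<subseteq> {u..v}" and uv: "u \<le> v"
  shows "finite P" "real (card P) \<le> (v - u) / \<eta> + 1"
proof -
  define f where "f = (\<lambda>x. \<lfloor>(x - u) / \<eta>\<rfloor>)"
  have less: "f x < f y" if "x \<in> P" "y \<in> P" "x < y" for x y
  proof -
    have "(x - u + \<eta>) / \<eta> \<le> (y - u) / \<eta>"
      using sep[OF that] \<eta> by (intro divide_right_mono) auto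
    then have "(x - u) / \<eta> + 1 \<le> (y - u) / \<eta>"
      using \<eta> by (simp add: add_divide_distrib)
    then show ?thesis unfolding f_def by linarith
  qed
  have inj: "inj_on f P"
    by (rule inj_onI) (metis less less_irrefl linorder_less_linear)
  have sub: "f ` P \<subseteq> {0..\<lfloor>(v - u) / \<eta>\<rfloor>}"
    using P \<eta> by (fastforce simp: f_def intro!: floor_mono divide_right_mono)
  show "finite P"
    using inj sub finite_imageD finite_subset by blast
  have "card P = card (f ` P)"
    using inj by (simp add: card_image)
  also have "\<dots> \<le> card {0..\<lfloor>(v - u) / \<eta>\<rfloor>}"
    using sub by (intro card_mono) auto
  finally have "card P \<le> nat (\<lfloor>(v - u) / \<eta>\<rfloor> + 1)" by simp
  moreover have "(v - u) / \<eta> \<ge> 0"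
    using \<eta> uv by simp
  ultimately show "real (card P) \<le> (v - u) / \<eta> + 1"
    by linarith
qed

text \<open>The relevant indices are 1-separated points of an interval of length
  \<open>2 * \<rho> * 2 ^ m + 1\<close>, so the previous count applies.\<close>

lemma card_cells_meeting_le:
  assumes "\<rho> \<ge> 0"
  shows "finite {i. \<exists>\<alpha>\<in>cell m i. \<bar>\<alpha> - x\<bar> \<le> \<rho>}"
    and "real (card {i. \<exists>\<alpha>\<in>cell m i. \<bar>\<alpha> - x\<bar> \<le> \<rho>}) \<le> 2 * \<rho> * 2 ^ m + 2"
proof -
  let ?I = "{i. \<exists>\<alpha>\<in>cell m i. \<bar>\<alpha> - x\<bar> \<le> \<rho>}"
  have sub: "real ` ?I \<subseteq> {(x - \<rho>) * 2 ^ m - 1..(x + \<rho>) * 2 ^ m}"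
  proof clarify
    fix i \<alpha>
    assume "\<alpha> \<in> cell m i" and \<alpha>: "\<bar>\<alpha> - x\<bar> \<le> \<rho>"
    then have "real i \<le> \<alpha> * 2 ^ m" "\<alpha> * 2 ^ m \<le> real i + 1"
      by (auto simp: cell_def field_simps)
    moreover have "(x - \<rho>) * 2 ^ m \<le> \<alpha> * 2 ^ m" "\<alpha> * 2 ^ m \<le> (x + \<rho>) * 2 ^ m"
      using \<alpha> by auto
    ultimately show "real i \<in> {(x - \<rho>) * 2 ^ m - 1..(x + \<rho>) * 2 ^ m}"
      unfolding atLeastAtMost_iff by linarith
  qed
  have le: "(x - \<rho>) * 2 ^ m - 1 \<le> (x + \<rho>) * 2 ^ m"
  proof -
    have "0 \<le> 2 * \<rho> * 2 ^ m" using assms by simp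
    then show ?thesis by (simp add: algebra_simps)
  qed
  have sep: "1 \<le> b - a" if "a \<in> real ` ?I" "b \<in> real ` ?I" "a < b" for a b
    using that by force
  have fin: "finite (real ` ?I)"
    by (rule card_separated_le(1)[OF sep _ sub le]) auto
  have "real (card (real ` ?I)) \<le> ((x + \<rho>) * 2 ^ m - ((x - \<rho>) * 2 ^ m - 1)) / 1 + 1"
    by (rule card_separated_le(2)[OF sep _ sub le]) auto
  also have "\<dots> = 2 * \<rho> * 2 ^ m + 2"
    by (simp add: algebra_simps)
  finally show "real (card ?I) \<le> 2 * \<rho> * 2 ^ m + 2"
    by (subst (asm) card_image) (auto simp: inj_on_def)
  show "finite ?I"
    using fin by (rule finite_imageD) (auto simp: inj_on_def)
qed

lemma cell_ancestor_subset: "cell (a + l) m \<subseteq> cell a (m div 2 ^ l)"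
proof
  fix x
  assume x: "x \<in> cell (a + l) m"
  let ?q = "m div 2 ^ l"
  have "?q * 2 ^ l \<le> m" "m + 1 \<le> (?q + 1) * 2 ^ l"
    using dividend_less_div_times[of "2 ^ l" m] by auto
  then have *: "real (?q * 2 ^ l) \<le> real m" "real (m + 1) \<le> real ((?q + 1) * 2 ^ l)"
    by (simp_all only: of_nat_le_iff)
  have "real ?q / 2 ^ a = real (?q * 2 ^ l) / 2 ^ (a + l)"
    by (simp add: power_add)
  also have "\<dots> \<le> real m / 2 ^ (a + l)"
    using * by (intro divide_right_mono) auto
  also have "\<dots> \<le> x"
    using x by (simp add: cell_def)
  finally have 1: "real ?q / 2 ^ a \<le> x" .
  have "x \<le> real (m + 1) / 2 ^ (a + l)"
    using x by (simp add: cell_def add.commute)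
  also have "\<dots> \<le> real ((?q + 1) * 2 ^ l) / 2 ^ (a + l)"
    using * by (intro divide_right_mono) auto
  also have "\<dots> = (real ?q + 1) / 2 ^ a"
    by (simp add: power_add field_simps)
  finally show "x \<in> cell a ?q"
    using 1 by (simp add: cell_def)
qed

text \<open>Only points of \<open>P\<close> within \<open>\<rho>\<close> of \<open>cell a i\<close>
  matter. They lie in an interval of length at most \<open>2 / 2 ^ a\<close>, so by separation there
  are at most \<open>4 * 2 ^ (j - a) + 1\<close> of them, and each meets few cells of the finer
  level.\<close>

lemma card_cells_hit_le:
  fixes P :: "real set" and a i j l :: nat
  assumes sep: "\<And>x y. x \<in> P \<Longrightarrow> y \<in> P \<Longrightarrow> x < y \<Longrightarrow> y - x \<ge> 1 / 2 ^ (j + 1)"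
    and \<rho>: "0 \<le> \<rho>" "\<rho> \<le> 1 / 2 ^ (a + 1)" and aj: "a \<le> j"
  defines "B \<equiv> {m. m div 2 ^ l = i \<and> (\<exists>x\<in>P. \<exists>\<alpha>\<in>cell (a + l) m. \<bar>\<alpha> - x\<bar> < \<rho>)}"
  shows "real (card B) \<le> 5 * 2 ^ (j - a) * (2 * \<rho> * 2 ^ (a + l) + 2)"
proof -
  define u v where "u = real i / 2 ^ a - \<rho>" and "v = (real i + 1) / 2 ^ a + \<rho>"
  let ?Q = "P \<inter> {u..v}"
  have uv: "v - u = 1 / 2 ^ a + 2 * \<rho>"
    by (simp add: u_def v_def field_simps)
  have sepQ: "y - x \<ge> 1 / 2 ^ (j + 1)" if "x \<in> ?Q" "y \<in> ?Q" "x < y" for x y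
    using sep that by blast
  have "u \<le> v" using uv \<rho> by (smt (verit) divide_nonneg_nonneg zero_le_power)
  note Q = card_separated_le[OF sepQ _ _ this]
  have finQ: "finite ?Q"
    by (rule Q) auto
  have "real (card ?Q) \<le> (v - u) / (1 / 2 ^ (j + 1)) + 1"
    by (rule Q) auto
  also have "\<dots> \<le> (2 / 2 ^ a) / (1 / 2 ^ (j + 1)) + 1"
    unfolding uv using \<rho> by (intro add_right_mono divide_right_mono) (auto simp: field_simps)
  also have "\<dots> = 4 * 2 ^ (j - a) + 1"
    using aj by (simp add: power_diff)
  also have "\<dots> \<le> 5 * 2 ^ (j - a)"
    by simp
  finally have cQ: "real (card ?Q) \<le> 5 * 2 ^ (j - a)" .
  let ?M = "\<lambda>x. {m. \<exists>\<alpha>\<in>cell (a + l) m. \<bar>\<alpha> - x\<bar> \<le> \<rho>}"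
  have "B \<subseteq> (\<Union>x\<in>?Q. ?M x)"
  proof
    fix m
    assume "m \<in> B"
    then obtain x \<alpha> where *: "m div 2 ^ l = i" "x \<in> P" "\<alpha> \<in> cell (a + l) m" "\<bar>\<alpha> - x\<bar> < \<rho>"
      by (auto simp: B_def)
    then have "\<alpha> \<in> cell a i"
      using cell_ancestor_subset by blast
    with * have "x \<in> {u..v}"
      by (auto simp: u_def v_def cell_def)
    with * show "m \<in> (\<Union>x\<in>?Q. ?M x)"
      by force
  qed
  then have "card B \<le> card (\<Union>x\<in>?Q. ?M x)"
    using finQ card_cells_meeting_le(1)[OF \<rho>(1)] by (intro card_mono) auto
  also have "\<dots> \<le> (\<Sum>x\<in>?Q. card (?M x))"
    by (rule card_UN_le[OF finQ])
  finally have "real (card B) \<le> (\<Sum>x\<in>?Q. real (card (?M x)))"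
    by (simp only: flip: of_nat_sum)
  also have "\<dots> \<le> (\<Sum>x\<in>?Q. 2 * \<rho> * 2 ^ (a + l) + 2)"
    using card_cells_meeting_le(2)[OF \<rho>(1)] by (intro sum_mono) auto
  also have "\<dots> = real (card ?Q) * (2 * \<rho> * 2 ^ (a + l) + 2)"
    by simp
  also have "\<dots> \<le> 5 * 2 ^ (j - a) * (2 * \<rho> * 2 ^ (a + l) + 2)"
    using cQ \<rho> by (intro mult_right_mono) auto
  finally show ?thesis .
qed

section \<open>Dyadic Cantor sets\<close>

lemma cell_ne [simp]: "cell m i \<noteq> {}"
  by (simp add: cell_def divide_right_mono)

lemma compact_cell [simp]: "compact (cell m i)"
  by (simp add: cell_def)

lemma finite_div_eq: "finite {m::nat. m div 2 ^ l = i}"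
proof (rule finite_subset)
  show "{m. m div 2 ^ l = i} \<subseteq> {..2 ^ l + i * 2 ^ l}"
  proof
    fix m :: nat
    assume "m \<in> {m. m div 2 ^ l = i}"
    then show "m \<in> {..2 ^ l + i * 2 ^ l}"
      using dividend_less_div_times[of "2 ^ l" m] by simp
  qed
qed simp

text \<open>
  \<open>S t\<close> contains the indices of the surviving intervals of length \<open>2 ^ - e t\<close>; an interval is cut
  into \<open>2 ^ r t\<close> pieces, exactly half of which survive.
\<close>

locale halving_tree =
  fixes e r :: "nat \<Rightarrow> nat" and S :: "nat \<Rightarrow> nat set" and root :: nat
  assumes e_Suc: "e (Suc t) = e t + r t"
    and r_pos: "r t \<ge> 1"
    and S_0: "S 0 = {root}"
    and S_parent: "m \<in> S (Suc t) \<Longrightarrow> m div 2 ^ r t \<in> S t"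
    and card_children: "i \<in> S t \<Longrightarrow> card {m \<in> S (Suc t). m div 2 ^ r t = i} = 2 ^ (r t - 1)"
    and r_at_top: "filterlim r at_top sequentially"
begin

section \<open>Ancestors, descendants and their numbers\<close>

definition desc :: "nat \<Rightarrow> nat \<Rightarrow> nat \<Rightarrow> nat set" where
  "desc t N i = {m \<in> S N. m div 2 ^ (e N - e t) = i}"

text \<open>The binary logarithm of the number of level \<open>N\<close> descendants of a surviving
  level \<open>t\<close> interval (see \<open>card_desc\<close>).\<close>

definition weight :: "nat \<Rightarrow> nat \<Rightarrow> nat" where
  "weight t N = (\<Sum>k=t..<N. r k - 1)"

definition limit_set :: "real set" where
  "limit_set = {\<alpha>. \<forall>t. \<exists>i\<in>S t. \<alpha> \<in> cell (e t) i}"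

lemma e_mono: "t \<le> N \<Longrightarrow> e t \<le> e N"
  by (rule lift_Suc_mono_le[of e]) (auto simp: e_Suc)

lemma div_Suc_level:
  assumes "t \<le> N"
  shows "(m::nat) div 2 ^ (e (Suc N) - e t) = (m div 2 ^ r N) div 2 ^ (e N - e t)"
proof -
  have "e (Suc N) - e t = r N + (e N - e t)"
    using e_mono[OF assms] by (simp add: e_Suc)
  then show ?thesis
    by (simp add: power_add div_mult2_eq)
qed

lemma ancestor_in_S:
  assumes "t \<le> N" "m \<in> S N"
  shows "m div 2 ^ (e N - e t) \<in> S t"
  using assms
proof (induction N arbitrary: m rule: dec_induct)
  case (step N)
  then show ?case
    by (simp add: div_Suc_level S_parent)
qed simp

lemma card_desc:
  assumes "t \<le> N" "i \<in> S t"
  shows "finite (desc t N i) \<and> card (desc t N i) = 2 ^ weight t N"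
  using assms(1)
proof (induction N rule: dec_induct)
  case base
  have "desc t t i = {i}"
    using assms by (auto simp: desc_def)
  then show ?case by (simp add: weight_def)
next
  case (step N)
  let ?ch = "\<lambda>m. {m' \<in> S (Suc N). m' div 2 ^ r N = m}"
  have eq: "desc t (Suc N) i = (\<Union>m\<in>desc t N i. ?ch m)"
    using step.hyps S_parent by (auto simp: desc_def div_Suc_level)
  have fin: "finite (?ch m)" for m
    using finite_div_eq[of "r N" m] by (rule finite_subset[rotated]) auto
  have card: "card (?ch m) = 2 ^ (r N - 1)" if "m \<in> desc t N i" for m
    using that by (intro card_children) (simp add: desc_def)
  have "card (desc t (Suc N) i) = (\<Sum>m\<in>desc t N i. card (?ch m))"
    unfolding eq using step.IH fin by (intro card_UN_disjoint) auto
  also have "\<dots> = 2 ^ weight t N * 2 ^ (r N - 1)"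
    using step.IH card by simp
  also have "\<dots> = 2 ^ weight t (Suc N)"
    using step.hyps by (simp add: weight_def power_add)
  finally have "card (desc t (Suc N) i) = 2 ^ weight t (Suc N)" .
  moreover have "finite (desc t (Suc N) i)"
    unfolding eq using step.IH fin by blast
  ultimately show ?case by simp
qed

lemma S_eq_desc: "S N = desc 0 N root"
proof -
  have "m div 2 ^ (e N - e 0) = root" if "m \<in> S N" for m
  proof -
    have "m div 2 ^ (e N - e 0) \<in> S 0"
      by (rule ancestor_in_S[OF _ that]) simp
    then show ?thesis unfolding S_0 by blast
  qed
  then show ?thesis
    unfolding desc_def by blast
qed

lemma finite_S: "finite (S N)" and card_S: "card (S N) = 2 ^ weight 0 N"
proof -
  have "root \<in> S 0"
    unfolding S_0 by blast
  then have "finite (desc 0 N root) \<and> card (desc 0 N root) = 2 ^ weight 0 N"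
    by (rule card_desc[OF le0])
  then show "finite (S N)" "card (S N) = 2 ^ weight 0 N"
    unfolding S_eq_desc[of N] by blast+
qed

lemma weight_add: "t \<le> N \<Longrightarrow> weight 0 N = weight 0 t + weight t N"
  unfolding weight_def using sum.atLeastLessThan_concat[of 0 t N "\<lambda>k. r k - 1"] by simp

text \<open>Halving costs one factor 2 per level, so the \<open>2 ^ weight 0 n\<close> survivors are
  fewer than all \<open>2 ^ (e n - e 0)\<close> descendants of the root by a factor of only
  \<open>2 ^ n\<close>. This is the loss to be absorbed in the dimension estimate.\<close>

lemma e_eq_weight: "e n = weight 0 n + n + e 0"
proof (induction n)
  case (Suc n)
  then show ?case
    using r_pos[of n] by (simp add: weight_def e_Suc)
qed (simp add: weight_def)

section \<open>The limit set and its compactness\<close>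

lemma cell_Suc_subset: "cell (e (Suc t)) m \<subseteq> cell (e t) (m div 2 ^ r t)"
  using cell_ancestor_subset[of "e t" "r t" m] by (simp add: e_Suc)

text \<open>Every survivor has surviving children, so an infinite branch starts at \<open>i\<close>;
  its nested compact cells share a point. Hence a cover of the limit set has to touch all survivors
  of every level.\<close>

lemma cell_meets_limit_set:
  assumes "i \<in> S t"
  shows "\<exists>\<alpha>\<in>limit_set. \<alpha> \<in> cell (e t) i"
proof -
  have "\<exists>f. \<forall>n. (f n \<in> S (t + n) \<and> (n = 0 \<longrightarrow> f n = i)) \<and> f (Suc n) div 2 ^ r (t + n) = f n"
  proof (rule dependent_nat_choice)
    fix m n
    assume "m \<in> S (t + n) \<and> (n = 0 \<longrightarrow> m = i)"
    then have "card {m' \<in> S (Suc (t + n)). m' div 2 ^ r (t + n) = m} \<noteq> 0"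
      by (simp add: card_children)
    then have "{m' \<in> S (Suc (t + n)). m' div 2 ^ r (t + n) = m} \<noteq> {}"
      by (metis card.empty)
    then show "\<exists>y. (y \<in> S (t + Suc n) \<and> (Suc n = 0 \<longrightarrow> y = i)) \<and> y div 2 ^ r (t + n) = m"
      by auto
  qed (use assms in auto)
  then obtain f where f: "\<And>n. f n \<in> S (t + n)" "f 0 = i"
      "\<And>n. f (Suc n) div 2 ^ r (t + n) = f n"
    by blast
  define J where "J = (\<lambda>n. cell (e (t + n)) (f n))"
  have "J (Suc n) \<subseteq> J n" for n
    using cell_Suc_subset[of "t + n" "f (Suc n)"] by (simp add: J_def f)
  then have "J n \<subseteq> J m" if "m \<le> n" for m n
    using that by (rule lift_Suc_antimono_le)
  then have "\<Inter> (range J) \<noteq> {}"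
    by (intro compact_nest) (auto simp: J_def)
  then obtain \<alpha> where \<alpha>: "\<And>n. \<alpha> \<in> J n"
    by auto
  have "\<exists>i\<in>S u. \<alpha> \<in> cell (e u) i" for u
  proof (cases "u \<le> t")
    case True
    have "cell (e t) i \<subseteq> cell (e u) (i div 2 ^ (e t - e u))"
      using cell_ancestor_subset[of "e u" "e t - e u" i] e_mono[OF True] by simp
    moreover have "\<alpha> \<in> cell (e t) i"
      using \<alpha>[of 0] f by (simp add: J_def)
    ultimately show ?thesis
      using ancestor_in_S[OF True assms] by blast
  next
    case False
    then have "u = t + (u - t)" by simp
    then show ?thesis
      using f(1)[of "u - t"] \<alpha>[of "u - t"] by (auto simp: J_def)
  qed
  moreover have "\<alpha> \<in> cell (e t) i"
    using \<alpha>[of 0] f by (simp add: J_def)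
  ultimately show ?thesis
    by (auto simp: limit_set_def)
qed

lemma compact_limit_set: "compact limit_set"
proof -
  have eq: "limit_set = (\<Inter>t. \<Union>i\<in>S t. cell (e t) i)"
    by (auto simp: limit_set_def)
  have K: "compact (\<Union>i\<in>S t. cell (e t) i)" for t
    using finite_S by (intro compact_UN) auto
  have "closed limit_set"
    unfolding eq using K by (intro closed_INT ballI compact_imp_closed)
  moreover have "bounded limit_set"
    using compact_imp_bounded[OF K[of 0]] by (rule bounded_subset) (auto simp: eq)
  ultimately show ?thesis
    by (simp add: compact_eq_bounded_closed)
qed

section \<open>Mass distribution on the limit set\<close>

lemma level_le:
  assumes "s < 1"
  obtains T where "\<And>n. real n \<le> real T + (1 - s) * real (e n)"
proof -
  \<comment> \<open>From level \<open>T\<close> on, \<open>r n\<close> is at least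
    \<open>1 / (1 - s)\<close>, so each further level raises \<open>(1 - s) * e n\<close> by at
    least 1; the additive \<open>T\<close> pays for the earlier levels.\<close>
  obtain T where T: "\<And>n. n \<ge> T \<Longrightarrow> r n \<ge> nat \<lceil>1 / (1 - s)\<rceil>"
    using r_at_top unfolding filterlim_at_top eventually_sequentially by meson
  have step: "1 \<le> (1 - s) * real (r n)" if "n \<ge> T" for n
  proof -
    have "real (r n) \<ge> 1 / (1 - s)"
      using T[OF that] by linarith
    then show ?thesis
      using assms by (simp add: field_simps)
  qed
  have "real n \<le> real T + (1 - s) * real (e n)" for n
  proof (induction n)
    case 0
    then show ?case using assms by simp
  next
    case (Suc n)
    show ?case
    proof (cases "n \<ge> T")
      case True
      then show ?thesis
        using Suc step[OF True] by (simp add: e_Suc algebra_simps)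
    next
      case False
      then have "real (Suc n) \<le> real T" by simp
      moreover have "0 \<le> (1 - s) * real (e (Suc n))"
        using assms by simp
      ultimately show ?thesis by linarith
    qed
  qed
  then show ?thesis by (rule that)
qed

text \<open>The uniform distribution on \<open>S N\<close> gives a ball of radius
  \<open>\<delta>\<close> mass at most \<open>C * \<delta> powr s\<close>. Choose \<open>n\<close>
  with \<open>1 / 2 ^ e (Suc n) \<le> \<delta> < 1 / 2 ^ e n\<close>: the ball meets at most
  \<open>4 * \<delta> * 2 ^ e (Suc n)\<close> cells of level \<open>Suc n\<close>, which carry equal
  mass. The resulting bound of order \<open>\<delta> * 2 ^ n\<close> is converted by
  \<open>level_le\<close>.\<close>

lemma card_meeting_ball_le:
  assumes s: "0 \<le> s" "s < 1"
  obtains C where "C \<ge> 1"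
    "\<And>u \<delta>. \<delta> > 0 \<Longrightarrow> \<exists>N0. \<forall>N\<ge>N0.
       real (card {m \<in> S N. cell (e N) m \<inter> ball u \<delta> \<noteq> {}}) \<le> C * \<delta> powr s * real (card (S N))"
proof -
  obtain T where T: "\<And>n. real n \<le> real T + (1 - s) * real (e n)"
    using level_le[OF s(2)] by blast
  \<comment> \<open>The 8 is 4 from counting cells times 2 from \<open>2 ^ Suc n\<close>;
    \<open>2 ^ e 0\<close> comes from \<open>e_eq_weight\<close> and \<open>2 ^ T\<close> from
    \<open>level_le\<close>.\<close>
  define C :: real where "C = 8 * 2 ^ e 0 * 2 ^ T"
  let ?M = "\<lambda>N u \<delta>. {m \<in> S N. cell (e N) m \<inter> ball u \<delta> \<noteq> {}}"
  have "\<exists>N0. \<forall>N\<ge>N0. real (card (?M N u \<delta>)) \<le> C * \<delta> powr s * real (card (S N))"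
    if \<delta>: "\<delta> > 0" for u \<delta> :: real
  proof (cases "\<delta> \<ge> 1 / 2 ^ e 0")
    \<comment> \<open>For a large ball the trivial bound by all of \<open>S N\<close> suffices,
      because \<open>C * \<delta> powr s\<close> is at least 1.\<close>
    case True
    have "1 = 2 ^ e 0 * (1 / 2 ^ e 0 :: real)" by simp
    also have "(1 / 2 ^ e 0 :: real) = (1 / 2 ^ e 0) powr 1" by simp
    also have "\<dots> \<le> (1 / 2 ^ e 0) powr s"
      using s by (intro powr_mono') auto
    also have "\<dots> \<le> \<delta> powr s"
      using True s by (intro powr_mono2) auto
    also have "2 ^ e 0 * \<delta> powr s \<le> C * \<delta> powr s"
    proof (intro mult_right_mono)
      have "(1::real) \<le> 2 ^ T" by simp
      then have "1 \<le> 8 * (2::real) ^ T" by linarith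
      then have "2 ^ e 0 * 1 \<le> 2 ^ e 0 * (8 * (2::real) ^ T)"
        by (intro mult_left_mono) auto
      then show "2 ^ e 0 \<le> C" by (simp add: C_def mult_ac)
    qed simp
    finally have 1: "1 \<le> C * \<delta> powr s" by simp
    have "real (card (?M N u \<delta>)) \<le> C * \<delta> powr s * real (card (S N))" for N
    proof -
      have "real (card (?M N u \<delta>)) \<le> 1 * real (card (S N))"
        using finite_S by (auto intro: card_mono)
      also have "\<dots> \<le> C * \<delta> powr s * real (card (S N))"
        using 1 by (intro mult_right_mono) auto
      finally show ?thesis .
    qed
    then show ?thesis by blast
  next
    case False
    have "\<exists>n. 1 / 2 ^ e n \<le> \<delta>"
    proof -
      obtain n where n: "(1 / 2 :: real) ^ n < \<delta>"
        using real_arch_pow_inv[OF \<delta>, of "1/2"] by auto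
      have "(1 / 2 :: real) ^ e n \<le> (1 / 2) ^ n"
        using e_eq_weight[of n] by (intro power_decreasing) auto
      with n show ?thesis
        by (intro exI[of _ n]) (simp add: power_one_over)
    qed
    then have least: "1 / 2 ^ e (LEAST n. 1 / 2 ^ e n \<le> \<delta>) \<le> \<delta>"
      by (rule LeastI_ex)
    with False have "(LEAST n. 1 / 2 ^ e n \<le> \<delta>) \<noteq> 0"
      by (metis (no_types, lifting))
    then obtain n where n: "(LEAST n. 1 / 2 ^ e n \<le> \<delta>) = Suc n"
      using not0_implies_Suc by blast
    have n1: "1 / 2 ^ e (Suc n) \<le> \<delta>"
      using least n by simp
    have n2: "\<delta> < 1 / 2 ^ e n"
      using not_less_Least[of n "\<lambda>n. 1 / 2 ^ e n \<le> \<delta>"] n by simp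
    \<comment> \<open>The spare power \<open>1 - s\<close> of \<open>\<delta>\<close>, which is
      below \<open>1 / 2 ^ e n\<close>, compensates the halving loss \<open>2 ^ n\<close>.\<close>
    have "\<delta> powr (1 - s) * 2 ^ n \<le> 2 ^ T"
    proof -
      have "\<delta> powr (1 - s) \<le> (1 / 2 ^ e n) powr (1 - s)"
        using \<delta> n2 s by (intro powr_mono2) auto
      also have "\<dots> = 2 powr (- ((1 - s) * real (e n)))"
      proof -
        have "1 / 2 ^ e n = 2 powr (- real (e n))"
          by (simp add: powr_minus powr_realpow divide_inverse)
        then show ?thesis by (simp add: powr_powr mult.commute)
      qed
      finally have "\<delta> powr (1 - s) * 2 ^ n \<le> 2 powr (- ((1 - s) * real (e n))) * 2 powr real n"
        by (simp add: powr_realpow)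
      also have "\<dots> \<le> 2 powr real T"
        using T[of n] by (simp flip: powr_add)
      finally show ?thesis by (simp add: powr_realpow)
    qed
    then have "\<delta> powr s * (\<delta> powr (1 - s) * 2 ^ n) \<le> \<delta> powr s * 2 ^ T"
      by (intro mult_left_mono) auto
    moreover have "\<delta> powr s * \<delta> powr (1 - s) = \<delta>"
      using \<delta> by (simp flip: powr_add)
    ultimately have scale: "\<delta> * 2 ^ n \<le> \<delta> powr s * 2 ^ T"
      by (metis mult.assoc)
    have "real (card (?M N u \<delta>)) \<le> C * \<delta> powr s * real (card (S N))" if N: "N \<ge> Suc n" for N
    proof -
      define I where "I = {i. \<exists>\<alpha>\<in>cell (e (Suc n)) i. \<bar>\<alpha> - u\<bar> \<le> \<delta>}"
      note I = card_cells_meeting_le[of \<delta> "e (Suc n)" u, folded I_def]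
      have "?M N u \<delta> \<subseteq> (\<Union>i\<in>I \<inter> S (Suc n). desc (Suc n) N i)"
      proof
        fix m
        assume m: "m \<in> ?M N u \<delta>"
        then obtain \<alpha> where \<alpha>: "\<alpha> \<in> cell (e N) m" "dist u \<alpha> < \<delta>"
          by auto
        then have "\<bar>\<alpha> - u\<bar> \<le> \<delta>"
          by (simp add: dist_real_def)
        let ?i = "m div 2 ^ (e N - e (Suc n))"
        have "cell (e N) m \<subseteq> cell (e (Suc n)) ?i"
          using cell_ancestor_subset[of "e (Suc n)" "e N - e (Suc n)" m] e_mono[OF N] by simp
        then have "?i \<in> I"
          using \<alpha>(1) \<open>\<bar>\<alpha> - u\<bar> \<le> \<delta>\<close> by (auto simp: I_def)
        moreover have "?i \<in> S (Suc n)"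
          using ancestor_in_S[OF N] m by simp
        moreover have "m \<in> desc (Suc n) N ?i"
          using m by (simp add: desc_def)
        ultimately show "m \<in> (\<Union>i\<in>I \<inter> S (Suc n). desc (Suc n) N i)"
          by blast
      qed
      then have "card (?M N u \<delta>) \<le> card (\<Union>i\<in>I \<inter> S (Suc n). desc (Suc n) N i)"
        using I(1) \<delta> card_desc[OF N] by (intro card_mono) auto
      also have "\<dots> \<le> (\<Sum>i\<in>I \<inter> S (Suc n). card (desc (Suc n) N i))"
        using I(1) \<delta> by (intro card_UN_le) auto
      also have "\<dots> = card (I \<inter> S (Suc n)) * 2 ^ weight (Suc n) N"
        using card_desc[OF N] by simp
      also have "\<dots> \<le> card I * 2 ^ weight (Suc n) N"
        using I(1) \<delta> by (intro mult_right_mono card_mono) auto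
      finally have "real (card (?M N u \<delta>)) \<le> real (card I * 2 ^ weight (Suc n) N)"
        by (rule of_nat_mono)
      also have "\<dots> = real (card I) * 2 ^ weight (Suc n) N"
        by simp
      also have "\<dots> \<le> (2 * \<delta> * 2 ^ e (Suc n) + 2) * 2 ^ weight (Suc n) N"
        using I(2) \<delta> by (intro mult_right_mono) auto
      also have "\<dots> \<le> (4 * \<delta> * 2 ^ e (Suc n)) * 2 ^ weight (Suc n) N"
        using n1 by (intro mult_right_mono) (auto simp: field_simps)
      also have "\<dots> = 8 * 2 ^ e 0 * (\<delta> * 2 ^ n) * 2 ^ weight 0 N"
        unfolding e_eq_weight[of "Suc n"] weight_add[OF N] by (simp add: power_add)
      also have "\<dots> \<le> 8 * 2 ^ e 0 * (\<delta> powr s * 2 ^ T) * 2 ^ weight 0 N"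
        using scale by (intro mult_right_mono mult_left_mono) auto
      also have "\<dots> = C * \<delta> powr s * real (card (S N))"
        by (simp add: C_def card_S)
      finally show ?thesis .
    qed
    then show ?thesis by blast
  qed
  moreover have "C \<ge> 1"
  proof -
    have "(1::real) \<le> 2 ^ (e 0 + T)" by simp
    then show ?thesis by (simp add: C_def power_add)
  qed
  ultimately show ?thesis using that by blast
qed

text \<open>Mass distribution principle with counting at one finite level in place of a limit
  measure: a cheap cover is enlarged to open balls, compactness leaves finitely many, and at a deep
  level these would meet at most half of the survivors although every survivor must be met.\<close>

lemma hausdorff_measure_ne_0:
  assumes A: "limit_set \<subseteq> A" and s: "0 \<le> s" "s < 1"
  shows "hausdorff_measure s A \<noteq> 0"
proof
  assume "hausdorff_measure s A = 0"
  then have pre: "hausdorff_premeasure s 1 A = 0"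
    unfolding hausdorff_measure_def by (metis SUP_upper greaterThan_iff le_zero_eq zero_less_one)
  obtain C where C: "C \<ge> 1" "\<And>u \<delta>. \<delta> > 0 \<Longrightarrow> \<exists>N0. \<forall>N\<ge>N0.
       real (card {m \<in> S N. cell (e N) m \<inter> ball u \<delta> \<noteq> {}}) \<le> C * \<delta> powr s * real (card (S N))"
    using card_meeting_ball_le[OF s] by blast
  \<comment> \<open>Enlarging the sets at most doubles the budget \<open>\<eta>\<close>, and
    \<open>C * (2 * \<eta>) = 1 / 2\<close> is then the contradictory proportion.\<close>
  define \<eta> where "\<eta> = 1 / (4 * C)"
  have \<eta>: "\<eta> > 0" "\<eta> < 1"
    using C by (auto simp: \<eta>_def)
  have "hausdorff_premeasure s 1 A < ennreal \<eta>"
    using pre \<eta> by simp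
  then obtain U :: "nat \<Rightarrow> real set" where U: "A \<subseteq> (\<Union>i. U i)" "\<And>i. bounded (U i)"
      "(\<Sum>i. diam_pow s (U i)) < ennreal \<eta>"
    unfolding hausdorff_premeasure_def Inf_less_iff by blast
  obtain \<alpha> where \<alpha>: "\<alpha> \<in> limit_set"
    using cell_meets_limit_set[of root 0] S_0 by auto
  \<comment> \<open>For \<open>s = 0\<close> a single nonempty set already contributes 1, above the
    budget; afterwards \<open>1 / s\<close> makes sense.\<close>
  have s0: "s > 0"
  proof (rule ccontr)
    assume "\<not> s > 0"
    with s have "s = 0" by simp
    obtain i where "\<alpha> \<in> U i"
      using \<alpha> A U(1) by blast
    then have "1 = diam_pow s (U i)"
      using \<open>s = 0\<close> by (auto simp: diam_pow_def)
    also have "\<dots> \<le> (\<Sum>i. diam_pow s (U i))"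
      using sum_le_suminf[of "\<lambda>i. diam_pow s (U i)" "{i}"] by simp
    also have "\<dots> < ennreal \<eta>" by (rule U)
    also have "\<dots> \<le> ennreal 1"
      using \<eta> by (intro ennreal_leI) simp
    finally show False by simp
  qed
  have ex: "\<exists>u \<delta>. \<delta> > 0 \<and> U i \<subseteq> ball u \<delta> \<and>
      ennreal (\<delta> powr s) \<le> diam_pow s (U i) + ennreal (\<eta> * (1 / 2) ^ Suc i)" for i
  proof -
    define D where "D = diameter (U i)"
    define h where "h = \<eta> * (1 / 2) ^ Suc i"
    \<comment> \<open>The radius strictly exceeds the diameter, even for a single point, yet its
      \<open>s\<close>-th power grows only by \<open>h\<close>; over all \<open>i\<close> these
      increments add up to \<open>\<eta>\<close>.\<close>
    define \<delta> where "\<delta> = (D powr s + h) powr (1 / s)"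
    have D: "D \<ge> 0" and h: "h > 0"
      using diameter_ge_0 U(2) \<eta> by (auto simp: D_def h_def)
    have pos: "D powr s + h > 0"
      using h by (simp add: add_nonneg_pos)
    have "D = (D powr s) powr (1 / s)"
      using D s0 by (simp add: powr_powr)
    also have "\<dots> < \<delta>"
      unfolding \<delta>_def using h s0 by (intro powr_less_mono2) auto
    finally have "D < \<delta>" .
    have \<delta>: "\<delta> powr s = D powr s + h"
      unfolding \<delta>_def using pos s0 by (simp add: powr_powr)
    show ?thesis
    proof (cases "U i = {}")
      case True
      then have "\<delta> powr s = h"
        using \<delta> s0 by (simp add: D_def)
      then have "ennreal (\<delta> powr s) \<le> diam_pow s (U i) + ennreal h"
        by simp
      then show ?thesis
        unfolding h_def using True \<open>D < \<delta>\<close> D by (intro exI[of _ 0] exI[of _ \<delta>]) simp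
    next
      case False
      then obtain u where u: "u \<in> U i" by blast
      have "U i \<subseteq> ball u \<delta>"
      proof
        fix x
        assume "x \<in> U i"
        then have "dist u x \<le> D"
          unfolding D_def by (rule diameter_bounded_bound[OF U(2) u])
        with \<open>D < \<delta>\<close> show "x \<in> ball u \<delta>" by simp
      qed
      moreover have "ennreal (\<delta> powr s) = diam_pow s (U i) + ennreal h"
        using False s0 h unfolding \<delta> by (simp add: diam_pow_def D_def)
      ultimately show ?thesis
        unfolding h_def using \<open>D < \<delta>\<close> D
        by (intro exI[of _ u] exI[of _ \<delta>]) (auto simp del: power_Suc)
    qed
  qed
  then obtain u \<delta> where \<delta>: "\<And>i. \<delta> i > 0" "\<And>i. U i \<subseteq> ball (u i) (\<delta> i)"
      "\<And>i. ennreal (\<delta> i powr s) \<le> diam_pow s (U i) + ennreal (\<eta> * (1 / 2) ^ Suc i)"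
    by metis
  have "limit_set \<subseteq> (\<Union>i\<in>UNIV. ball (u i) (\<delta> i))"
    using A U(1) \<delta>(2) by blast
  from compactE_image[OF compact_limit_set _ this]
  obtain F where F: "finite F" "limit_set \<subseteq> (\<Union>i\<in>F. ball (u i) (\<delta> i))"
    by (metis open_ball)
  have geo: "(\<Sum>i\<in>F. \<eta> * (1 / 2) ^ Suc i) \<le> \<eta>"
  proof -
    have "(\<lambda>i. \<eta> * (1 / 2) ^ Suc i) sums (\<eta> * 1)"
      by (intro sums_mult power_half_series)
    then show ?thesis
      using sum_le_suminf[of "\<lambda>i. \<eta> * (1 / 2) ^ Suc i" F] F \<eta> by (simp add: sums_iff)
  qed
  have "ennreal (\<Sum>i\<in>F. \<delta> i powr s) = (\<Sum>i\<in>F. ennreal (\<delta> i powr s))"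
    by simp
  also have "\<dots> \<le> (\<Sum>i\<in>F. diam_pow s (U i) + ennreal (\<eta> * (1 / 2) ^ Suc i))"
    by (intro sum_mono \<delta>(3))
  also have "\<dots> = (\<Sum>i\<in>F. diam_pow s (U i)) + ennreal (\<Sum>i\<in>F. \<eta> * (1 / 2) ^ Suc i)"
    using \<eta> by (subst sum_ennreal[symmetric]) (auto simp: sum.distrib)
  also have "\<dots> \<le> ennreal \<eta> + ennreal \<eta>"
  proof (intro add_mono ennreal_leI geo)
    show "(\<Sum>i\<in>F. diam_pow s (U i)) \<le> ennreal \<eta>"
      using sum_le_suminf[of "\<lambda>i. diam_pow s (U i)" F] F U(3) by (simp add: order.trans[OF _ less_imp_le])
  qed
  also have "\<dots> = ennreal (2 * \<eta>)"
    using \<eta> by (simp flip: ennreal_plus)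
  finally have sum_le: "(\<Sum>i\<in>F. \<delta> i powr s) \<le> 2 * \<eta>"
    using \<eta> by (subst (asm) ennreal_le_iff) auto
  have "\<forall>i. \<exists>N0. \<forall>N\<ge>N0. real (card {m \<in> S N. cell (e N) m \<inter> ball (u i) (\<delta> i) \<noteq> {}})
          \<le> C * \<delta> i powr s * real (card (S N))"
    using C(2) \<delta>(1) by blast
  from choice[OF this] obtain N0 where N0: "\<And>i N. N \<ge> N0 i \<Longrightarrow>
      real (card {m \<in> S N. cell (e N) m \<inter> ball (u i) (\<delta> i) \<noteq> {}})
        \<le> C * \<delta> i powr s * real (card (S N))"
    by blast
  \<comment> \<open>The sum of the finitely many thresholds dominates each of them.\<close>
  define N where "N = sum N0 F"
  let ?M = "\<lambda>i. {m \<in> S N. cell (e N) m \<inter> ball (u i) (\<delta> i) \<noteq> {}}"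
  have N: "N \<ge> N0 i" if "i \<in> F" for i
    unfolding N_def using that F(1) by (intro member_le_sum) auto
  have "S N \<subseteq> (\<Union>i\<in>F. ?M i)"
  proof
    fix m
    assume m: "m \<in> S N"
    then obtain \<alpha> where "\<alpha> \<in> limit_set" "\<alpha> \<in> cell (e N) m"
      using cell_meets_limit_set by blast
    with m F(2) show "m \<in> (\<Union>i\<in>F. ?M i)"
      by blast
  qed
  then have "card (S N) \<le> card (\<Union>i\<in>F. ?M i)"
    using F(1) finite_S by (intro card_mono) auto
  also have "\<dots> \<le> (\<Sum>i\<in>F. card (?M i))"
    by (rule card_UN_le[OF F(1)])
  finally have "real (card (S N)) \<le> real (\<Sum>i\<in>F. card (?M i))"
    by (rule of_nat_mono)
  also have "\<dots> = (\<Sum>i\<in>F. real (card (?M i)))"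
    by (rule of_nat_sum)
  also have "\<dots> \<le> (\<Sum>i\<in>F. C * \<delta> i powr s * real (card (S N)))"
    by (intro sum_mono N0 N)
  also have "\<dots> = C * (\<Sum>i\<in>F. \<delta> i powr s) * real (card (S N))"
    by (simp add: sum_distrib_left sum_distrib_right)
  also have "\<dots> \<le> C * (2 * \<eta>) * real (card (S N))"
    using sum_le C by (intro mult_right_mono mult_left_mono) auto
  also have "\<dots> = real (card (S N)) / 2"
    using C by (simp add: \<eta>_def)
  finally show False
    by (simp add: card_S)
qed

end

section \<open>Avoiding unions of separated sets\<close>

text \<open>The constant is \<open>12800 = 2 * 10 * 20 * 32\<close>: 2 from
  \<open>j + 1 \<le> 2 * j\<close>, 10 from the cell count, 20 from \<open>step_le\<close>, and 32
  so that the removed widths take a share of at most \<open>1/32\<close>.\<close>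

definition rho :: "nat \<Rightarrow> real" where
  "rho j = 1 / (12800 * 2 ^ j * (real j * ln (real j)))"

text \<open>Chosen so that \<open>2 ^ step a\<close> is at least \<open>512 * a\<close>, with
  \<open>512 = 2 ^ 9\<close>, while \<open>step a\<close> stays logarithmic in
  \<open>a\<close>.\<close>

definition step :: "nat \<Rightarrow> nat" where
  "step a = nat \<lceil>log 2 (real a)\<rceil> + 9"

text \<open>These are the exponents of the construction. Starting at 16 ensures
  \<open>ln (level t) \<ge> 1\<close> throughout.\<close>

primrec level :: "nat \<Rightarrow> nat" where
  "level 0 = 16"
| "level (Suc t) = level t + step (level t)"

section \<open>Elementary bounds for the scales and radii\<close>

lemma one_le_ln: "a \<ge> 16 \<Longrightarrow> 1 \<le> ln (real a)"
  using exp_le by (subst ln_ge_iff) auto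

lemma step_ge: "a \<ge> 16 \<Longrightarrow> 512 * a \<le> 2 ^ step a"
proof -
  assume a: "a \<ge> 16"
  have "real a = 2 powr log 2 (real a)"
    using a by simp
  also have "\<dots> \<le> 2 powr real (nat \<lceil>log 2 (real a)\<rceil>)"
    by (intro powr_mono real_nat_ceiling_ge) auto
  also have "\<dots> = real (2 ^ nat \<lceil>log 2 (real a)\<rceil>)"
    by (simp add: powr_realpow)
  finally have "a \<le> 2 ^ nat \<lceil>log 2 (real a)\<rceil>"
    by (simp only: of_nat_le_iff)
  then show ?thesis
    by (simp add: step_def power_add)
qed

text \<open>Since \<open>ln 2 \<ge> 2 / 3\<close>, the binary logarithm is at most
  \<open>3 / 2 * ln a\<close>, and the additive 10 is at most \<open>10 * ln a\<close>.\<close>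

lemma step_le: "a \<ge> 16 \<Longrightarrow> real (step a) \<le> 20 * ln (real a)"
proof -
  assume a: "a \<ge> 16"
  note one = one_le_ln[OF a]
  have "log 2 (real a) \<ge> 0"
    using a by simp
  then have "real (step a) \<le> log 2 (real a) + 10"
    unfolding step_def by linarith
  also have "log 2 (real a) \<le> ln (real a) / (2 / 3)"
    unfolding log_def using one ln2_ge_two_thirds by (intro divide_left_mono) auto
  also have "ln (real a) / (2 / 3) + 10 \<le> 20 * ln (real a)"
    using one by simp
  finally show ?thesis by simp
qed

lemma rho_nonneg: "0 \<le> rho j"
  by (cases j) (auto simp: rho_def)

lemma rho_le: "16 \<le> a \<Longrightarrow> a \<le> j \<Longrightarrow> rho j \<le> 1 / 2 ^ (a + 1)"
proof -
  assume a: "16 \<le> a" and j: "a \<le> j"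
  have "1 * 1 \<le> real j * ln (real j)"
    using a j one_le_ln[of j] by (intro mult_mono) auto
  moreover have "(2::real) ^ a \<le> 2 ^ j"
    using j by (intro power_increasing) auto
  ultimately have "2 ^ a * 1 \<le> 2 ^ j * (real j * ln (real j))"
    by (intro mult_mono) auto
  moreover have "0 < (2::real) ^ a"
    by simp
  ultimately have "2 * 2 ^ a \<le> 12800 * (2 ^ j * (real j * ln (real j)))"
    by linarith
  then have "2 ^ (a + 1) \<le> 12800 * 2 ^ j * (real j * ln (real j))"
    by (simp add: mult.assoc)
  then show ?thesis
    unfolding rho_def by (intro frac_le) auto
qed

text \<open>
  In the bound for a single \<open>j\<close>, the summand with \<open>rho j\<close> comes from the width of the removed
  intervals: summed over \<open>r \<le> 20 * ln a\<close> values of \<open>j\<close> it stays small because of the factor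
  \<open>ln j\<close> in \<open>rho j\<close>. The other summand comes from their number, which is why \<open>2 ^ r'\<close> has to
  exceed a multiple of \<open>b\<close>.
\<close>

lemma card_removed_le:
  fixes Z :: "nat \<Rightarrow> nat \<Rightarrow> real set" and a b l r r' i :: nat
  assumes sep: "\<And>j k x y. x \<in> Z j k \<Longrightarrow> y \<in> Z j k \<Longrightarrow> x < y \<Longrightarrow> y - x \<ge> 1 / 2 ^ (j + 1)"
    and a: "a \<ge> 16" and b: "b = a + r" and l: "l = r + r'"
    and r: "real r \<le> 20 * ln (real a)" and r': "512 * b \<le> 2 ^ r'"
  shows "16 * card {m. m div 2 ^ l = i \<and> (\<exists>j\<in>{a..<b}. \<exists>k\<le>j. \<exists>x\<in>Z j k.
           \<exists>\<alpha>\<in>cell (a + l) m. \<bar>\<alpha> - x\<bar> < rho j)} \<le> 2 ^ l" (is "16 * card ?B \<le> _")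
proof -
  let ?Bjk = "\<lambda>j k. {m. m div 2 ^ l = i \<and> (\<exists>x\<in>Z j k. \<exists>\<alpha>\<in>cell (a + l) m. \<bar>\<alpha> - x\<bar> < rho j)}"
  have fin: "finite (?Bjk j k)" for j k
    using finite_div_eq[of l i] by (rule finite_subset[rotated]) auto
  note one = one_le_ln[OF a]
  have "?B \<subseteq> (\<Union>j\<in>{a..<b}. \<Union>k\<in>{..j}. ?Bjk j k)"
    by blast
  then have "card ?B \<le> card (\<Union>j\<in>{a..<b}. \<Union>k\<in>{..j}. ?Bjk j k)"
    using fin by (intro card_mono finite_UN_I) auto
  also have "\<dots> \<le> (\<Sum>j\<in>{a..<b}. card (\<Union>k\<in>{..j}. ?Bjk j k))"
    by (intro card_UN_le) simp
  also have "\<dots> \<le> (\<Sum>j\<in>{a..<b}. \<Sum>k\<in>{..j}. card (?Bjk j k))"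
    by (intro sum_mono card_UN_le) simp
  finally have "real (card ?B) \<le> real (\<Sum>j\<in>{a..<b}. \<Sum>k\<in>{..j}. card (?Bjk j k))"
    by (rule of_nat_mono)
  also have "\<dots> = (\<Sum>j\<in>{a..<b}. \<Sum>k\<in>{..j}. real (card (?Bjk j k)))"
    by simp
  also have "\<dots> \<le> (\<Sum>j\<in>{a..<b}. \<Sum>k\<in>{..j}. 5 * 2 ^ (j - a) * (2 * rho j * 2 ^ (a + l) + 2))"
    using a rho_le by (intro sum_mono card_cells_hit_le[OF sep rho_nonneg]) auto
  also have "\<dots> = (\<Sum>j\<in>{a..<b}. (real j + 1) * (5 * 2 ^ (j - a) * (2 * rho j * 2 ^ (a + l) + 2)))"
    by (simp add: add.commute)
  also have "\<dots> \<le> (\<Sum>j\<in>{a..<b}. 2 ^ l / (640 * ln (real a)) + 10 * real b * 2 ^ (j - a))"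
  proof (rule sum_mono)
    fix j
    assume j: "j \<in> {a..<b}"
    have lnj: "ln (real a) \<le> ln (real j)"
      using a j by simp
    have pow: "(2::real) ^ (j - a) * 2 ^ (a + l) = 2 ^ j * 2 ^ l"
      using j by (simp flip: power_add)
    have "(real j + 1) * (5 * 2 ^ (j - a) * (2 * rho j * 2 ^ (a + l)))
            = (real j + 1) * 10 * rho j * (2 ^ (j - a) * 2 ^ (a + l))"
      by simp
    also have "\<dots> = 2 ^ l * ((real j + 1) / (1280 * (real j * ln (real j))))"
      unfolding pow using a j one lnj by (simp add: rho_def field_simps)
    also have "\<dots> \<le> 2 ^ l * (1 / (640 * ln (real a)))"
    proof (intro mult_left_mono)
      \<comment> \<open>Here \<open>j + 1 \<le> 2 * j\<close> halves the constant 1280, and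
        monotonicity replaces \<open>ln j\<close> by \<open>ln a\<close>, making the bound
        independent of \<open>j\<close>.\<close>
      have "(real j + 1) * (640 * ln (real a)) \<le> (2 * real j) * (640 * ln (real j))"
        using a j lnj one by (intro mult_mono) auto
      then show "(real j + 1) / (1280 * (real j * ln (real j))) \<le> 1 / (640 * ln (real a))"
        using a j one lnj by (simp add: divide_le_eq le_divide_eq field_simps)
    qed simp
    finally have 1: "(real j + 1) * (5 * 2 ^ (j - a) * (2 * rho j * 2 ^ (a + l)))
            \<le> 2 ^ l / (640 * ln (real a))" by simp
    have "real j + 1 \<le> real b"
      using j by auto
    then have "(real j + 1) * (10 * 2 ^ (j - a)) \<le> real b * (10 * 2 ^ (j - a))"
      by (intro mult_right_mono) auto
    with 1 show "(real j + 1) * (5 * 2 ^ (j - a) * (2 * rho j * 2 ^ (a + l) + 2))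
            \<le> 2 ^ l / (640 * ln (real a)) + 10 * real b * 2 ^ (j - a)"
      by (simp add: algebra_simps)
  qed
  also have "\<dots> = real r * (2 ^ l / (640 * ln (real a))) + 10 * real b * (\<Sum>j\<in>{a..<b}. 2 ^ (j - a))"
    by (simp add: sum.distrib sum_distrib_left b)
  \<comment> \<open>Widths and numbers each get half of the allowed \<open>1/16\<close>: the widths
    by \<open>20 / 640 = 1 / 32\<close>, the numbers because
    \<open>10 * 32 \<le> 512\<close>.\<close>
  also have "\<dots> \<le> 2 ^ l / 32 + 2 ^ l / 32"
  proof (rule add_mono)
    have "real r * (2 ^ l / (640 * ln (real a))) \<le> 20 * ln (real a) * (2 ^ l / (640 * ln (real a)))"
      using r one by (intro mult_right_mono) auto
    then show "real r * (2 ^ l / (640 * ln (real a))) \<le> 2 ^ l / 32"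
      using one by simp
    have "(\<Sum>j\<in>{a..<b}. (2::real) ^ (j - a)) = (\<Sum>j<r. 2 ^ j)"
      by (rule sum.reindex_bij_witness[of _ "\<lambda>j. j + a" "\<lambda>j. j - a"]) (auto simp: b)
    also have "\<dots> \<le> 2 ^ r"
      by (simp add: geometric_sum)
    finally have "10 * real b * (\<Sum>j\<in>{a..<b}. 2 ^ (j - a)) \<le> 10 * real b * 2 ^ r"
      by (intro mult_left_mono) auto
    also have "\<dots> \<le> 2 ^ r' / 32 * 2 ^ r"
    proof (intro mult_right_mono)
      have "real (512 * b) \<le> real (2 ^ r')"
        using r' by (simp only: of_nat_le_iff)
      then show "10 * real b \<le> 2 ^ r' / 32" by simp
    qed simp
    also have "\<dots> = 2 ^ l / 32"
      by (simp add: l power_add)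
    finally show "10 * real b * (\<Sum>j\<in>{a..<b}. 2 ^ (j - a)) \<le> 2 ^ l / 32" .
  qed
  finally have "real (16 * card ?B) \<le> real (2 ^ l)"
    by simp
  then show ?thesis
    by (simp only: of_nat_le_iff)
qed

section \<open>Stages of the construction and the surviving tree\<close>

lemma level_ge: "level t \<ge> 16 + t"
  by (induction t) (auto simp: step_def)

lemma level_bracket:
  assumes "j \<ge> 16"
  obtains t where "level t \<le> j" "j < level (Suc t)"
proof -
  define n where "n = (LEAST t. j < level t)"
  have "j < level j"
    using level_ge[of j] by simp
  then have n: "j < level n"
    unfolding n_def by (rule LeastI)
  with assms have "n \<noteq> 0"
    by (intro notI) simp
  then obtain t where t: "n = Suc t"
    using not0_implies_Suc by blast
  then have "\<not> j < level t"
    unfolding n_def using not_less_Least by (metis lessI)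
  with n t that[of t] show ?thesis by simp
qed

lemma filterlim_step_level: "filterlim (\<lambda>t. step (level t)) at_top sequentially"
  unfolding filterlim_at_top eventually_sequentially
proof (intro allI)
  fix M
  have "M \<le> step (level t)" if "t \<ge> 2 ^ M" for t
  proof -
    have "(2::nat) ^ M \<le> 2 ^ step (level t)"
      using that level_ge[of t] step_ge[of "level t"] by linarith
    then show ?thesis by simp
  qed
  then show "\<exists>N. \<forall>t\<ge>N. M \<le> step (level t)" by blast
qed

text \<open>A halving tree is grown inside the avoiding set. Among the children of a good node at
  most a quarter are bad and at most a quarter have too many bad children themselves, so half of
  them can be kept and all kept ones are good again.\<close>

lemma hausdorff_measure_avoiding_ne_0:
  fixes Z :: "nat \<Rightarrow> nat \<Rightarrow> real set"
  assumes sep: "\<And>j k x y. x \<in> Z j k \<Longrightarrow> y \<in> Z j k \<Longrightarrow> x < y \<Longrightarrow> y - x \<ge> 1 / 2 ^ (j + 1)"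
    and A: "{\<alpha>. \<forall>j\<ge>16. \<forall>k\<le>j. \<forall>x\<in>Z j k. rho j \<le> \<bar>\<alpha> - x\<bar>} \<subseteq> A"
    and s: "0 \<le> s" "s < 1"
  shows "hausdorff_measure s A \<noteq> 0"
proof -
  define r where "r = (\<lambda>t. step (level t))"
  \<comment> \<open>A level \<open>t\<close> interval is \<open>bad\<close> because of heights two levels up, so that the removal
    decided at one level takes place among its grandchildren. Retaining only nodes with few
    bad children makes the surviving tree homogeneous. For \<open>t < 2\<close> the range of \<open>j\<close> is empty.\<close>
  define bad where "bad = (\<lambda>t i. \<exists>j\<in>{level (t - 2)..<level (t - 1)}. \<exists>k\<le>j. \<exists>x\<in>Z j k.
      \<exists>\<alpha>\<in>cell (level t) i. \<bar>\<alpha> - x\<bar> < rho j)"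
  define bad_children where "bad_children = (\<lambda>t i. {m. m div 2 ^ r t = i \<and> bad (Suc t) m})"
  define good where "good = (\<lambda>t i. \<not> bad t i \<and> 4 * card (bad_children t i) \<le> 2 ^ r t)"
  have r9: "r t \<ge> 9" for t
    by (simp add: r_def step_def)
  have fin: "finite (bad_children t i)" for t i
    unfolding bad_children_def using finite_div_eq[of "r t" i] by (rule finite_subset[rotated]) auto
  have bad_grandchildren:
    "16 * card {m. m div 2 ^ (r t + r (Suc t)) = i \<and> bad (Suc (Suc t)) m} \<le> 2 ^ (r t + r (Suc t))"
    for t i
  proof -
    have 16: "level t \<ge> 16" "level (Suc t) \<ge> 16"
      using level_ge[of t] level_ge[of "Suc t"] by linarith+
    have "level (Suc (Suc t)) = level t + (r t + r (Suc t))"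
      by (simp add: r_def)
    then have bad_eq: "bad (Suc (Suc t)) m \<longleftrightarrow> (\<exists>j\<in>{level t..<level (Suc t)}. \<exists>k\<le>j. \<exists>x\<in>Z j k.
        \<exists>\<alpha>\<in>cell (level t + (r t + r (Suc t))) m. \<bar>\<alpha> - x\<bar> < rho j)" for m
      by (simp add: bad_def del: level.simps)
    have "level (Suc t) = level t + r t"
      by (simp add: r_def)
    moreover have "real (r t) \<le> 20 * ln (real (level t))" "512 * level (Suc t) \<le> 2 ^ r (Suc t)"
      unfolding r_def using step_le[OF 16(1)] step_ge[OF 16(2)] .
    ultimately show ?thesis
      unfolding bad_eq by (intro card_removed_le[OF sep 16(1) _ refl])
  qed
  have good_children: "2 ^ (r t - 1) \<le> card {m. m div 2 ^ r t = i \<and> good (Suc t) m}"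
    if "good t i" for t i
  proof -
    define Ch where "Ch = {m. m div 2 ^ r t = i}"
    define Bd where "Bd = {m \<in> Ch. 4 * card (bad_children (Suc t) m) > 2 ^ r (Suc t)}"
    have Ch: "finite Ch" "card Ch = 2 ^ r t"
    proof -
      have iff: "m div 2 ^ r t = i \<longleftrightarrow> i * 2 ^ r t \<le> m \<and> m < i * 2 ^ r t + 2 ^ r t" for m :: nat
        using dividend_less_div_times[of "2 ^ r t" m]
        by (auto simp: add.commute mult.commute intro!: div_nat_eqI)
      have "Ch = {i * 2 ^ r t..<i * 2 ^ r t + 2 ^ r t}"
        by (simp only: Ch_def iff set_eq_iff mem_Collect_eq atLeastLessThan_iff simp_thms)
      then show "finite Ch" "card Ch = 2 ^ r t" by auto
    qed
    \<comment> \<open>Double counting: each member of \<open>Bd\<close> has more than a quarter of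
      its children bad, and these are bad grandchildren of \<open>i\<close>, whose share is at most
      \<open>1/16\<close>. Hence \<open>Bd\<close> is at most a quarter of
      \<open>Ch\<close>.\<close>
    have "16 * (card Bd * 2 ^ r (Suc t)) \<le> 4 * 2 ^ (r t + r (Suc t))"
    proof -
      have "card Bd * 2 ^ r (Suc t) \<le> (\<Sum>m\<in>Bd. 4 * card (bad_children (Suc t) m))"
        using sum_mono[of Bd "\<lambda>_. 2 ^ r (Suc t)" "\<lambda>m. 4 * card (bad_children (Suc t) m)"]
        by (auto simp: Bd_def)
      also have "\<dots> = 4 * card (\<Union>m\<in>Bd. bad_children (Suc t) m)"
        using Ch fin by (subst card_UN_disjoint)
          (auto simp: sum_distrib_left Bd_def bad_children_def)
      also have "(\<Union>m\<in>Bd. bad_children (Suc t) m)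
          \<subseteq> {m. m div 2 ^ (r t + r (Suc t)) = i \<and> bad (Suc (Suc t)) m}"
      proof -
        have "(2::nat) ^ (r t + r (Suc t)) = 2 ^ r (Suc t) * 2 ^ r t"
          by (simp add: power_add)
        then have "m div 2 ^ (r t + r (Suc t)) = m div 2 ^ r (Suc t) div 2 ^ r t" for m :: nat
          by (simp only: div_mult2_eq)
        then show ?thesis
          by (auto simp: Bd_def Ch_def bad_children_def)
      qed
      then have "card (\<Union>m\<in>Bd. bad_children (Suc t) m)
          \<le> card {m. m div 2 ^ (r t + r (Suc t)) = i \<and> bad (Suc (Suc t)) m}"
        by (rule card_mono[rotated])
          (rule finite_subset[OF _ finite_div_eq[of "r t + r (Suc t)" i]], auto)
      finally show ?thesis
        using bad_grandchildren[of t i] by simp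
    qed
    then have "4 * card Bd \<le> 2 ^ r t"
      by (simp add: power_add)
    moreover have "4 * card (bad_children t i) \<le> 2 ^ r t"
      using that by (simp add: good_def)
    moreover have "Ch \<subseteq> {m. m div 2 ^ r t = i \<and> good (Suc t) m} \<union> Bd \<union> bad_children t i"
      by (auto simp: Ch_def Bd_def good_def bad_children_def)
    then have "card Ch \<le> card ({m. m div 2 ^ r t = i \<and> good (Suc t) m} \<union> Bd \<union> bad_children t i)"
      using Ch fin by (intro card_mono) (auto simp: Bd_def Ch_def)
    then have "card Ch \<le> card {m. m div 2 ^ r t = i \<and> good (Suc t) m} + card Bd
        + card (bad_children t i)"
      by (meson add_right_mono card_Un_le order_trans)
    moreover have "(2::nat) ^ r t = 2 * 2 ^ (r t - 1)"
      using r9[of t] by (simp flip: power_Suc)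
    ultimately show ?thesis
      using Ch by linarith
  qed
  have "\<exists>P. good t i \<longrightarrow> P \<subseteq> {m. m div 2 ^ r t = i \<and> good (Suc t) m} \<and> card P = 2 ^ (r t - 1)" for t i
    using good_children[of t i] obtain_subset_with_card_n by meson
  then obtain pick where pick: "\<And>t i. good t i \<Longrightarrow>
      pick t i \<subseteq> {m. m div 2 ^ r t = i \<and> good (Suc t) m} \<and> card (pick t i) = 2 ^ (r t - 1)"
    by metis
  define S where "S = rec_nat {0} (\<lambda>t X. \<Union>i\<in>X. pick t i)"
  have S0: "S 0 = {0}" and S_Suc: "S (Suc t) = (\<Union>i\<in>S t. pick t i)" for t
    by (simp_all add: S_def)
  \<comment> \<open>Truncated subtraction makes the range of \<open>j\<close> empty in
    \<open>bad 0\<close> and \<open>bad 1\<close>, so neither the root nor its children are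
    bad.\<close>
  have "good 0 0"
    by (simp add: good_def bad_def bad_children_def)
  have S_good: "good t i" if "i \<in> S t" for t i
    using that
  proof (induction t arbitrary: i)
    case 0
    then show ?case using S0 \<open>good 0 0\<close> by simp
  next
    case (Suc t)
    then show ?case using S_Suc pick by blast
  qed
  have child: "m div 2 ^ r t = i" if "i \<in> S t" "m \<in> pick t i" for m t i
    using that pick S_good by blast
  interpret halving_tree level r S 0
  proof
    show "level (Suc t) = level t + r t" "r t \<ge> 1" for t
      using r9[of t] by (simp_all add: r_def)
    show "m div 2 ^ r t \<in> S t" if "m \<in> S (Suc t)" for m t
      using that child by (auto simp: S_Suc)
    show "card {m \<in> S (Suc t). m div 2 ^ r t = i} = 2 ^ (r t - 1)" if "i \<in> S t" for i t
    proof -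
      have "{m \<in> S (Suc t). m div 2 ^ r t = i} = pick t i"
        using that child by (auto simp: S_Suc)
      then show ?thesis
        using pick S_good that by simp
    qed
    show "filterlim r at_top sequentially"
      unfolding r_def by (rule filterlim_step_level)
  qed (rule S0)
  have "limit_set \<subseteq> {\<alpha>. \<forall>j\<ge>16. \<forall>k\<le>j. \<forall>x\<in>Z j k. rho j \<le> \<bar>\<alpha> - x\<bar>}"
  proof clarify
    fix \<alpha> j k x
    assume \<alpha>: "\<alpha> \<in> limit_set" and "16 \<le> j" "k \<le> j" "x \<in> Z j k"
    then obtain t where t: "level t \<le> j" "j < level (Suc t)"
      using level_bracket by blast
    obtain i where i: "i \<in> S (Suc (Suc t))" "\<alpha> \<in> cell (level (Suc (Suc t))) i"
      using \<alpha> unfolding limit_set_def by blast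
    then have "\<not> bad (Suc (Suc t)) i"
      using S_good by (simp add: good_def)
    \<comment> \<open>Heights between levels \<open>t\<close> and \<open>t + 1\<close> are tested on
      the intervals of level \<open>t + 2\<close>, which explains the choice of
      \<open>i\<close>.\<close>
    moreover have "j \<in> {level (Suc (Suc t) - 2)..<level (Suc (Suc t) - 1)}"
      using t by simp
    ultimately show "rho j \<le> \<bar>\<alpha> - x\<bar>"
      unfolding bad_def using i \<open>k \<le> j\<close> \<open>x \<in> Z j k\<close> not_less by blast
  qed
  then have "limit_set \<subseteq> A"
    using A by (rule order_trans)
  then show ?thesis
    using s by (rule hausdorff_measure_ne_0)
qed

section \<open>The mixed Littlewood setting\<close>

lemma Dprod_ge:
  assumes "\<And>k. k \<ge> 1 \<Longrightarrow> d k \<ge> 2"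
  shows "Dprod d n \<ge> 2 ^ n"
proof (induction n)
  case (Suc n)
  have "2 ^ n * 2 \<le> Dprod d n * d (Suc n)"
    using assms[of "Suc n"] Suc order_trans[OF zero_le_power Suc] by (intro mult_mono) auto
  then show ?case
    by (simp add: Dprod_def mult.commute)
qed (simp add: Dprod_def)

text \<open>As \<open>2 ^ n \<le> Dprod d n \<le> q\<close> whenever \<open>Dprod d n\<close>
  divides \<open>q\<close>, only finitely many \<open>n\<close> compete and the infimum is a
  minimum.\<close>

lemma pseudo_abs_attained:
  assumes "\<And>k. k \<ge> 1 \<Longrightarrow> d k \<ge> 2" and "q > 0"
  obtains k where "Dprod d k dvd q" "pseudo_abs d q = inverse (real_of_int (Dprod d k))"
proof -
  let ?N = "{n. Dprod d n dvd q}"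
  let ?X = "{inverse (real_of_int (Dprod d n)) | n. Dprod d n dvd q}"
  have "?N \<subseteq> {..nat q}"
  proof
    fix n
    assume "n \<in> ?N"
    then have "Dprod d n \<le> q"
      using \<open>q > 0\<close> by (simp add: zdvd_imp_le)
    moreover have "int n < 2 ^ n"
      by (rule of_nat_less_two_power)
    ultimately have "int n \<le> q"
      using Dprod_ge[where d = d and n = n, OF assms(1)] by linarith
    then show "n \<in> {..nat q}"
      by simp
  qed
  then have "finite ?X"
    using finite_subset by (auto simp: setcompr_eq_image)
  moreover have "?X \<noteq> {}"
    by (auto intro!: exI[of _ 0] simp: Dprod_def)
  ultimately have "Inf ?X \<in> ?X"
    by (metis (no_types, lifting) Min_in cInf_eq_Min)
  then show ?thesis
    using that unfolding pseudo_abs_def by blast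
qed

text \<open>
  If \<open>k\<close> attains the infimum in \<open>|q|\<^sub>D\<close>, the condition on \<open>q\<close> says \<open>2 ^ j \<le> q\<^sup>2 |q|\<^sub>D < 2 ^ (j + 1)\<close>.
\<close>

definition resonant :: "(nat \<Rightarrow> int) \<Rightarrow> nat \<Rightarrow> nat \<Rightarrow> real set" where
  "resonant d j k = {real_of_int p / real_of_int q | p q. q > 0 \<and> Dprod d k dvd q \<and>
     2 ^ j * Dprod d k \<le> q\<^sup>2 \<and> q\<^sup>2 < 2 ^ (j + 1) * Dprod d k}"

text \<open>Both denominators are multiples \<open>D * m1\<close> and \<open>D * m2\<close> of
  \<open>D = Dprod d k\<close>, so the difference is a positive integer over
  \<open>D * m1 * m2\<close>, with \<open>D\<close> appearing only once. That denominator is at most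
  \<open>D * (max m1 m2)\<^sup>2\<close>, hence at most \<open>2 ^ (j + 1)\<close>.\<close>

lemma resonant_separated:
  assumes "Dprod d k > 0" and x: "x \<in> resonant d j k" and y: "y \<in> resonant d j k" and "x < y"
  shows "y - x \<ge> 1 / 2 ^ (j + 1)"
proof -
  let ?D = "Dprod d k"
  have rep: "\<exists>p m. z = real_of_int p / (real_of_int ?D * real_of_int m) \<and> m > 0 \<and> ?D * m\<^sup>2 < 2 ^ (j + 1)"
    if z: "z \<in> resonant d j k" for z
  proof -
    obtain p q where pq: "z = real_of_int p / real_of_int q" "q > 0" "?D dvd q"
        "q\<^sup>2 < 2 ^ (j + 1) * ?D"
      using z unfolding resonant_def by blast
    then obtain m where m: "q = ?D * m" by blast
    then have "m > 0"
      using pq assms(1) by (simp add: zero_less_mult_iff)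
    moreover have "?D * (?D * m\<^sup>2) < ?D * 2 ^ (j + 1)"
      using pq(4) by (simp add: m power2_eq_square mult_ac)
    then have "?D * m\<^sup>2 < 2 ^ (j + 1)"
      using assms(1) mult_less_cancel_left_pos by blast
    ultimately show ?thesis
      using pq(1) m by auto
  qed
  obtain p1 m1 where 1: "x = real_of_int p1 / (real_of_int ?D * real_of_int m1)" "m1 > 0"
      "?D * m1\<^sup>2 < 2 ^ (j + 1)"
    using rep[OF x] by blast
  obtain p2 m2 where 2: "y = real_of_int p2 / (real_of_int ?D * real_of_int m2)" "m2 > 0"
      "?D * m2\<^sup>2 < 2 ^ (j + 1)"
    using rep[OF y] by blast
  have "?D * (m1 * m2) \<le> ?D * (max m1 m2)\<^sup>2"
    unfolding power2_eq_square using 1 2 assms(1) by (intro mult_left_mono mult_mono) auto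
  also have "\<dots> \<le> 2 ^ (j + 1)"
    using 1 2 by (simp add: max_def)
  finally have "real_of_int (?D * (m1 * m2)) \<le> real_of_int (2 ^ (j + 1))"
    by (simp only: of_int_le_iff)
  then have le: "real_of_int ?D * (real_of_int m1 * real_of_int m2) \<le> 2 ^ (j + 1)"
    by simp
  have pos: "real_of_int ?D * (real_of_int m1 * real_of_int m2) > 0"
    using 1 2 assms(1) by simp
  have diff: "y - x = real_of_int (p2 * m1 - p1 * m2) / (real_of_int ?D * (real_of_int m1 * real_of_int m2))"
    unfolding 1(1) 2(1) using 1(2) 2(2) assms(1) by (simp add: field_simps)
  have "real_of_int (p2 * m1 - p1 * m2) > 0"
    using \<open>x < y\<close> pos diff by (metis diff_gt_0_iff_gt zero_less_divide_iff less_asym)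
  then have "0 < p2 * m1 - p1 * m2"
    by (simp only: of_int_0_less_iff)
  then have "1 \<le> p2 * m1 - p1 * m2"
    by simp
  then have "real_of_int (p2 * m1 - p1 * m2) \<ge> 1"
    by (simp only: of_int_1_le_iff)
  then show ?thesis
    unfolding diff using le pos by (intro frac_le) auto
qed

text \<open>All fractions \<open>p / q\<close> with this \<open>q\<close> lie in one class
  \<open>resonant d j k\<close>, so \<open>dist_int (q * \<alpha>)\<close> is at least
  \<open>q * rho j\<close>. Then \<open>q\<^sup>2 / Dprod d k \<ge> 2 ^ j\<close> cancels the power
  of 2 in \<open>rho j\<close>, and the two logarithms cancel \<open>j * ln j\<close> up to a
  constant.\<close>

lemma resonant_avoiding_ge:
  fixes q :: nat
  assumes d: "\<And>k. k \<ge> 1 \<Longrightarrow> d k \<ge> 2"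
    and avoid: "\<And>j k x. 16 \<le> j \<Longrightarrow> k \<le> j \<Longrightarrow> x \<in> resonant d j k \<Longrightarrow> rho j \<le> \<bar>\<alpha> - x\<bar>"
    and q: "q \<ge> 2 ^ 16"
  shows "real q * ln (real q) * ln (ln (real q)) * pseudo_abs d (int q) * dist_int (real q * \<alpha>)
           \<ge> 1 / 76800"
proof -
  have q0: "int q > 0" "real q > 0"
    using q by auto
  obtain k where k: "Dprod d k dvd int q" "pseudo_abs d (int q) = inverse (real_of_int (Dprod d k))"
    using pseudo_abs_attained[where d = d, OF d q0(1)] by blast
  let ?D = "Dprod d k"
  have D: "2 ^ k \<le> ?D"
    by (rule Dprod_ge[where d = d, OF d])
  then have D0: "?D > 0"
    by (meson less_le_trans zero_less_numeral zero_less_power)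
  obtain m where m: "int q = ?D * m"
    using k(1) by blast
  then have "m > 0"
    using q0(1) D0 by (simp add: zero_less_mult_iff)
  \<comment> \<open>The height \<open>q\<^sup>2 / Dprod d k\<close>. It is an integer because
    \<open>Dprod d k\<close> divides \<open>q\<close>, and it is at least \<open>q\<close>, which
    forces \<open>j \<ge> 16\<close>.\<close>
  define H where "H = nat (int q * m)"
  have H: "int H = int q * m"
    using \<open>m > 0\<close> by (simp add: H_def)
  have HD: "int H * ?D = (int q)\<^sup>2"
    by (simp add: H m power2_eq_square mult_ac)
  have "int q * 1 \<le> int H"
    unfolding H using \<open>m > 0\<close> by (intro mult_left_mono) auto
  then have qH: "q \<le> H" by simp
  obtain j where j: "2 ^ j \<le> H" "H < 2 ^ (j + 1)"
    using ex_power_ivl1[of 2 H] q qH by auto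
  have "j \<ge> 16"
  proof (rule ccontr)
    assume "\<not> j \<ge> 16"
    then have "(2::nat) ^ (j + 1) \<le> 2 ^ 16"
      by (intro power_increasing) auto
    with j(2) q qH show False by linarith
  qed
  \<comment> \<open>The chain \<open>2 ^ k \<le> ?D \<le> q \<le> H < 2 ^ (j + 1)\<close> shows that
    only classes with \<open>k \<le> j\<close> occur.\<close>
  have "?D \<le> int q"
    using k(1) q0(1) by (rule zdvd_imp_le)
  moreover have "int q < int (2 ^ (j + 1))"
    using qH j(2) by (simp only: of_nat_less_iff)
  then have "int q < 2 ^ (j + 1)"
    by simp
  ultimately have "(2::int) ^ k < 2 ^ (j + 1)"
    using D by linarith
  then have "k < j + 1"
    by (rule power_less_imp_less_exp[rotated]) simp
  then have "k \<le> j"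
    by simp
  have lo: "2 ^ j * ?D \<le> (int q)\<^sup>2"
  proof -
    have "int (2 ^ j) * ?D \<le> int H * ?D"
      using j(1) D0 by (intro mult_right_mono) (auto simp only: of_nat_le_iff)
    then show ?thesis by (simp add: HD)
  qed
  have hi: "(int q)\<^sup>2 < 2 ^ (j + 1) * ?D"
  proof -
    have "int H * ?D < int (2 ^ (j + 1)) * ?D"
      using j(2) D0 by (intro mult_strict_right_mono) (auto simp only: of_nat_less_iff)
    then show ?thesis by (simp add: HD)
  qed
  have dist_ge: "real q * rho j \<le> dist (real q * \<alpha>) z" if "z \<in> \<int>" for z
  proof -
    obtain p where p: "z = real_of_int p"
      using \<open>z \<in> \<int>\<close> by (auto elim: Ints_cases)
    have "real_of_int p / real_of_int (int q) \<in> resonant d j k"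
      unfolding resonant_def using q0(1) k(1) lo hi by blast
    then have "rho j \<le> \<bar>\<alpha> - real_of_int p / real q\<bar>"
      using avoid[OF \<open>16 \<le> j\<close> \<open>k \<le> j\<close>] by simp
    then have "real q * rho j \<le> real q * \<bar>\<alpha> - real_of_int p / real q\<bar>"
      by (intro mult_left_mono) auto
    also have "\<dots> = \<bar>real q * (\<alpha> - real_of_int p / real q)\<bar>"
      by (simp add: abs_mult)
    also have "\<dots> = dist (real q * \<alpha>) z"
      using q0(2) by (simp add: p dist_real_def right_diff_distrib)
    finally show ?thesis .
  qed
  have "(\<int> :: real set) \<noteq> {}"
    using Ints_0 by blast
  then have dist_int: "real q * rho j \<le> dist_int (real q * \<alpha>)"
    unfolding dist_int_def using dist_ge by (simp add: infdist_notempty cINF_greatest)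
  have real_lo: "2 ^ j * real_of_int ?D \<le> (real q)\<^sup>2"
  proof -
    have "real_of_int (2 ^ j * ?D) \<le> real_of_int ((int q)\<^sup>2)"
      using lo by (simp only: of_int_le_iff)
    then show ?thesis by simp
  qed
  have jr: "real j \<ge> 16"
    using \<open>j \<ge> 16\<close> by simp
  have one: "1 \<le> ln (real j)"
    by (rule one_le_ln[OF \<open>j \<ge> 16\<close>])
  \<comment> \<open>Take logarithms in \<open>2 ^ j \<le> q\<^sup>2\<close> and use
    \<open>ln 2 \<ge> 2 / 3\<close>.\<close>
  have ln_q: "real j / 3 \<le> ln (real q)"
  proof -
    have "2 ^ j * 1 \<le> 2 ^ j * real_of_int ?D"
      using D0 by (intro mult_left_mono) auto
    with real_lo have "2 ^ j \<le> (real q)\<^sup>2" by linarith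
    then have "ln (2 ^ j) \<le> ln ((real q)\<^sup>2)"
      using q0(2) by simp
    then have "real j * ln 2 \<le> 2 * ln (real q)"
      using q0(2) by (simp add: ln_realpow)
    moreover have "real j * (2 / 3) \<le> real j * ln 2"
      using ln2_ge_two_thirds by (intro mult_left_mono) auto
    ultimately show ?thesis by simp
  qed
  \<comment> \<open>For \<open>j \<ge> 9\<close> one has \<open>j \<le> (j / 3)\<^sup>2\<close>, so
    passing from \<open>j\<close> to \<open>j / 3\<close> at most halves the logarithm.\<close>
  have lnln_q: "ln (real j) / 2 \<le> ln (ln (real q))"
  proof -
    have "real j * 9 \<le> real j * real j"
      using jr by (intro mult_left_mono) auto
    then have "real j \<le> (real j / 3)\<^sup>2"
      by (simp add: power2_eq_square)
    then have "ln (real j) \<le> ln ((real j / 3)\<^sup>2)"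
      using jr by (subst ln_le_cancel_iff) auto
    also have "\<dots> = 2 * ln (real j / 3)"
      using jr by (simp add: ln_realpow)
    also have "ln (real j / 3) \<le> ln (ln (real q))"
      using jr ln_q by (subst ln_le_cancel_iff) auto
    finally show ?thesis by simp
  qed
  \<comment> \<open>The denominators 3 and 2 combine with the 12800 of \<open>rho\<close> to
    \<open>76800\<close>.\<close>
  have "1 / 76800 = (real j / 3) * (ln (real j) / 2) * (2 ^ j * rho j)"
    using jr one by (simp add: rho_def)
  also have "\<dots> \<le> ln (real q) * ln (ln (real q)) * ((real q)\<^sup>2 / real_of_int ?D * rho j)"
    using jr one ln_q lnln_q real_lo D0 rho_nonneg
    by (intro mult_mono mult_nonneg_nonneg) (auto simp: le_divide_eq)
  also have "\<dots> = real q * ln (real q) * ln (ln (real q)) * inverse (real_of_int ?D) * (real q * rho j)"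
    by (simp add: power2_eq_square divide_inverse)
  also have "\<dots> \<le> real q * ln (real q) * ln (ln (real q)) * inverse (real_of_int ?D)
      * dist_int (real q * \<alpha>)"
    using jr one ln_q lnln_q D0 dist_int by (intro mult_left_mono mult_nonneg_nonneg) auto
  finally show ?thesis
    by (simp add: k(2))
qed

theorem theorem1:
  fixes d :: "nat \<Rightarrow> int"
  assumes "\<And>k. k \<ge> 1 \<Longrightarrow> d k \<ge> 2"
  shows "hausdorff_dim
           {\<alpha>::real. liminf (\<lambda>q::nat. ereal (real q * ln (real q) * ln (ln (real q))
                        * pseudo_abs d (int q) * dist_int (real q * \<alpha>))) > 0} = 1"
    (is "hausdorff_dim ?A = 1")
proof (rule antisym)
  show "hausdorff_dim ?A \<le> 1"
    by (rule hausdorff_dim_real_le_1)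
next
  have D0: "Dprod d k > 0" for k
    using Dprod_ge[where d = d and n = k, OF assms] by (meson less_le_trans zero_less_numeral zero_less_power)
  \<comment> \<open>On the avoiding set the expression is at least \<open>1 / 76800\<close> from
    \<open>2 ^ 16\<close> on, so its liminf is positive.\<close>
  have sub: "{\<alpha>. \<forall>j\<ge>16. \<forall>k\<le>j. \<forall>x\<in>resonant d j k. rho j \<le> \<bar>\<alpha> - x\<bar>} \<subseteq> ?A"
  proof clarify
    fix \<alpha> :: real
    let ?f = "\<lambda>q::nat. real q * ln (real q) * ln (ln (real q))
                        * pseudo_abs d (int q) * dist_int (real q * \<alpha>)"
    assume "\<forall>j\<ge>16. \<forall>k\<le>j. \<forall>x\<in>resonant d j k. rho j \<le> \<bar>\<alpha> - x\<bar>"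
    then have "1 / 76800 \<le> ?f q" if "q \<ge> 2 ^ 16" for q
      using that by (intro resonant_avoiding_ge[where d = d, OF assms]) auto
    then have "eventually (\<lambda>q. ereal (1 / 76800) \<le> ereal (?f q)) sequentially"
      unfolding eventually_sequentially ereal_less_eq by blast
    then have "ereal (1 / 76800) \<le> liminf (\<lambda>q. ereal (?f q))"
      by (rule Liminf_bounded)
    moreover have "0 < ereal (1 / 76800)"
      by simp
    ultimately show "0 < liminf (\<lambda>q. ereal (?f q))"
      by (rule less_le_trans[rotated])
  qed
  have "1 \<le> s" if s: "0 \<le> s" "hausdorff_measure s ?A = 0" for s
  proof (rule ccontr)
    assume "\<not> 1 \<le> s"
    then have "hausdorff_measure s ?A \<noteq> 0"
      using hausdorff_measure_avoiding_ne_0[OF resonant_separated[OF D0] sub] s(1) by simp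
    with s(2) show False by blast
  qed
  then show "1 \<le> hausdorff_dim ?A"
    unfolding hausdorff_dim_def by (intro INF_greatest) auto
qed

end
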